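(* Let $C$ be a (finite or infinite) set, $H=\ell^2(C)$, and for $k\ge 0$ let $H_k=\ell^2(C^k)$, let $B_k$ be the closed unit ball of $H_k^{S_k}$, and let $R_k=\{r_1\otimes\cdots\otimes r_k\mid r_1,\ldots,r_k\in B(H)\}\subseteq H_k$. Let $\mathcal{F}$ be the collection of simple graphs and define $\pi:\prod_{k=0}^\infty H_k^{S_k}\to\mathbb{R}^{\mathcal{F}}$ by $$\pi(h)(F)=\sum_{\phi:E(F)\to C}\prod_{v\in V(F)}h_{\deg(v)}(\phi(\delta(v)))$$ for $h=(h_k)_{k\ge0}$. Then $\pi$ is continuous on $\prod_{k\in\mathbb{N}}(B_k,d_{R_k})$ (product topology on the domain, product topology on $\mathbb{R}^{\mathcal{F}}$).
   Context: $\ell^2(X)$ is the real Hilbert space of functions $f:X\to\mathbb{R}$ with $\sum_x f(x)^2<\infty$; $H_0=\ell^2(C^0)\cong\mathbb{R}$. $B(H)$ denotes the closed unit ball of $H$. $S_k$ acts on $H_k$ by permuting the $k$ coordinates, and $H_k^{S_k}$ is the set of $S_k$-invariant elements. $(r_1\otimes\cdots\otimes r_k)(c_1,\ldots,c_k)=\prod_i r_i(c_i)$. For a subset $R\subseteq H_k$, $\|x\|_R:=\sup_{r\in R}|\langle r,x\rangle|$ and $d_R(x,y):=\|x-y\|_R$; $(B_k,d_{R_k})$ is $B_k$ with the topology of this pseudometric. For a vertex $v$ of $F$, $\deg(v)$ is its degree and $\delta(v)=(e_1,\ldots,e_k)$ is the set of edges incident with $v$ in an arbitrary order, and $\phi(\delta(v))=(\phi(e_1),\ldots,\phi(e_k))\in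 C^k$ (the order is irrelevant by $S_k$-invariance). The sum defining $\pi$ converges. *)

theory Defs
  imports "HOL-Analysis.Analysis" "HOL-Combinatorics.Permutations"
begin

section \<open>Real square-summable functions on a set\<close>

text \<open>Elements of \<open>\<ell>\<^sup>2(X)\<close> are represented by functions on the ambient type that vanish outside \<open>X\<close>,
  so that distinct representatives denote distinct elements. Over the reals, \<open>summable_on\<close> and
  \<open>infsum\<close> describe unconditional (equivalently, absolute) summation.\<close>

definition ell2 :: "'x set \<Rightarrow> ('x \<Rightarrow> real) set" where
  "ell2 X = {f. (\<forall>x. x \<notin> X \<longrightarrow> f x = 0) \<and> (\<lambda>x. (f x)\<^sup>2) summable_on X}"

definition ell2_inner :: "'x set \<Rightarrow> ('x \<Rightarrow> real) \<Rightarrow> ('x \<Rightarrow> real) \<Rightarrow> real" where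
  "ell2_inner X f g = (\<Sum>\<^sub>\<infinity>x\<in>X. f x * g x)"

definition ell2_norm :: "'x set \<Rightarrow> ('x \<Rightarrow> real) \<Rightarrow> real" where
  "ell2_norm X f = sqrt (ell2_inner X f f)"

definition ell2_ball :: "'x set \<Rightarrow> ('x \<Rightarrow> real) set" where
  "ell2_ball X = {f \<in> ell2 X. ell2_norm X f \<le> 1}"

text \<open>The supremum is a real one: it is meaningful when \<open>R\<close> is nonempty and norm-bounded in
  \<open>\<ell>\<^sup>2(X)\<close> and \<open>f \<in> \<ell>\<^sup>2(X)\<close>, by the Cauchy--Schwarz inequality. This is the case for all the sets
  \<open>rank_one C k\<close> below.\<close>

definition ell2_seminorm :: "'x set \<Rightarrow> ('x \<Rightarrow> real) set \<Rightarrow> ('x \<Rightarrow> real) \<Rightarrow> real" where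
  "ell2_seminorm X R f = (SUP r\<in>R. \<bar>ell2_inner X r f\<bar>)"

definition ell2_dist :: "'x set \<Rightarrow> ('x \<Rightarrow> real) set \<Rightarrow> ('x \<Rightarrow> real) \<Rightarrow> ('x \<Rightarrow> real) \<Rightarrow> real" where
  "ell2_dist X R f g = ell2_seminorm X R (\<lambda>x. f x - g x)"

section \<open>The topology of a pseudometric\<close>

text \<open>The library's \<open>Metric_space\<close> requires that distinct points have positive distance, hence this
  version.\<close>

definition pseudometric_topology :: "'a set \<Rightarrow> ('a \<Rightarrow> 'a \<Rightarrow> real) \<Rightarrow> 'a topology" where
  "pseudometric_topology M d =
     topology (\<lambda>U. U \<subseteq> M \<and> (\<forall>x\<in>U. \<exists>\<epsilon>>0. \<forall>y\<in>M. d x y < \<epsilon> \<longrightarrow> y \<in> U))"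

lemma openin_pseudometric_topology:
  "openin (pseudometric_topology M d) U \<longleftrightarrow>
     U \<subseteq> M \<and> (\<forall>x\<in>U. \<exists>\<epsilon>>0. \<forall>y\<in>M. d x y < \<epsilon> \<longrightarrow> y \<in> U)"
proof -
  let ?L = "\<lambda>U. U \<subseteq> M \<and> (\<forall>x\<in>U. \<exists>\<epsilon>>0. \<forall>y\<in>M. d x y < \<epsilon> \<longrightarrow> y \<in> U)"
  have "istopology ?L"
    unfolding istopology_def
  proof (intro conjI allI impI)
    fix S T assume S: "?L S" and T: "?L T"
    show "S \<inter> T \<subseteq> M" using S by blast
    show "\<forall>x\<in>S \<inter> T. \<exists>\<epsilon>>0. \<forall>y\<in>M. d x y < \<epsilon> \<longrightarrow> y \<in> S \<inter> T"
    proof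
      fix x assume "x \<in> S \<inter> T"
      then obtain a b where "a > 0" "\<forall>y\<in>M. d x y < a \<longrightarrow> y \<in> S"
        and "b > 0" "\<forall>y\<in>M. d x y < b \<longrightarrow> y \<in> T"
        using S T by blast
      then show "\<exists>\<epsilon>>0. \<forall>y\<in>M. d x y < \<epsilon> \<longrightarrow> y \<in> S \<inter> T"
        by (intro exI[of _ "min a b"]) auto
    qed
  next
    fix K assume K: "\<forall>U\<in>K. ?L U"
    show "\<Union>K \<subseteq> M" using K by blast
    show "\<forall>x\<in>\<Union>K. \<exists>\<epsilon>>0. \<forall>y\<in>M. d x y < \<epsilon> \<longrightarrow> y \<in> \<Union>K"
    proof
      fix x assume "x \<in> \<Union>K"
      then obtain U where "U \<in> K" "x \<in> U" by blast
      then show "\<exists>\<epsilon>>0. \<forall>y\<in>M. d x y < \<epsilon> \<longrightarrow> y \<in> \<Union>K"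
        using K by (meson UnionI)
    qed
  qed
  then show ?thesis
    by (simp add: pseudometric_topology_def topology_inverse')
qed

lemma topspace_pseudometric_topology: "topspace (pseudometric_topology M d) = M"
proof
  show "topspace (pseudometric_topology M d) \<subseteq> M"
    by (auto simp: topspace_def openin_pseudometric_topology)
  have "openin (pseudometric_topology M d) M"
    by (auto simp: openin_pseudometric_topology intro: exI[of _ "1::real"])
  then show "M \<subseteq> topspace (pseudometric_topology M d)"
    by (rule openin_subset)
qed

section \<open>Symmetric functions and rank-one tensors on \<open>C\<^sup>k\<close>\<close>

text \<open>\<open>C\<^sup>k\<close> is the set of lists of length \<open>k\<close> over \<open>C\<close>; in particular \<open>C\<^sup>0 = {[]}\<close>.\<close>

definition tuples :: "'c set \<Rightarrow> nat \<Rightarrow> 'c list set" where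
  "tuples C k = {cs. length cs = k \<and> set cs \<subseteq> C}"

definition sym_ell2 :: "'c set \<Rightarrow> nat \<Rightarrow> ('c list \<Rightarrow> real) set" where
  "sym_ell2 C k = {h \<in> ell2 (tuples C k).
     \<forall>\<sigma>. \<sigma> permutes {..<k} \<longrightarrow> (\<forall>cs\<in>tuples C k. h (permute_list \<sigma> cs) = h cs)}"

definition sym_ball :: "'c set \<Rightarrow> nat \<Rightarrow> ('c list \<Rightarrow> real) set" where
  "sym_ball C k = {h \<in> sym_ell2 C k. ell2_norm (tuples C k) h \<le> 1}"

text \<open>When every factor vanishes outside \<open>C\<close>, the tensor vanishes outside \<open>C\<^sup>k\<close>, where \<open>k\<close> is the
  number of factors.\<close>

definition tensor :: "('c \<Rightarrow> real) list \<Rightarrow> 'c list \<Rightarrow> real" where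
  "tensor rs cs = (if length cs = length rs then \<Prod>i<length rs. (rs ! i) (cs ! i) else 0)"

definition rank_one :: "'c set \<Rightarrow> nat \<Rightarrow> ('c list \<Rightarrow> real) set" where
  "rank_one C k = {tensor rs | rs. length rs = k \<and> set rs \<subseteq> ell2_ball C}"

definition sym_ball_topology :: "'c set \<Rightarrow> nat \<Rightarrow> ('c list \<Rightarrow> real) topology" where
  "sym_ball_topology C k =
     pseudometric_topology (sym_ball C k) (ell2_dist (tuples C k) (rank_one C k))"

section \<open>Simple graphs and the partition function\<close>

text \<open>A graph is a pair of a finite vertex set and a set of two-element sets of vertices.\<close>

type_synonym 'v sgraph = "'v set \<times> 'v set set"

definition simple_graphs :: "'v sgraph set" where
  "simple_graphs = {(V, E). finite V \<and> E \<subseteq> {e. e \<subseteq> V \<and> card e = 2}}"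

definition incident_edges :: "'v sgraph \<Rightarrow> 'v \<Rightarrow> 'v set set" where
  "incident_edges F v = {e \<in> snd F. v \<in> e}"

definition vertex_degree :: "'v sgraph \<Rightarrow> 'v \<Rightarrow> nat" where
  "vertex_degree F v = card (incident_edges F v)"

text \<open>Some enumeration of the incident edges. Which one is chosen does not matter below, since it is
  only used as an argument of permutation-invariant functions.\<close>

definition edge_order :: "'v sgraph \<Rightarrow> 'v \<Rightarrow> 'v set list" where
  "edge_order F v = (SOME es. distinct es \<and> set es = incident_edges F v)"

text \<open>Colourings \<open>E(F) \<rightarrow> C\<close> are extensional functions, so that each is counted once. Likewise, the
  value of \<open>partition_map\<close> is extensional in the graph, i.e. a point of the product
  \<open>\<real>\<^bsup>simple_graphs\<^esup>\<close>.\<close>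

definition partition_map ::
    "'c set \<Rightarrow> (nat \<Rightarrow> 'c list \<Rightarrow> real) \<Rightarrow> 'v sgraph \<Rightarrow> real" where
  "partition_map C h = (\<lambda>F\<in>simple_graphs.
     \<Sum>\<^sub>\<infinity>\<phi>\<in>(snd F \<rightarrow>\<^sub>E C). \<Prod>v\<in>fst F. h (vertex_degree F v) (map \<phi> (edge_order F v)))"

end

theory Submission
  imports Defs
begin

text \<open>For a fixed graph \<open>F\<close> the map \<open>h \<mapsto> \<pi>(h)(F)\<close> is Lipschitz: \<open>\<bar>\<pi>(h)(F) - \<pi>(h')(F)\<bar>\<close> is at most the sum of
  \<open>d\<^sub>R(h\<^sub>k, h'\<^sub>k)\<close>, \<open>k = deg(v)\<close>, over the vertices \<open>v\<close>. Exchange \<open>h\<close> for \<open>h'\<close> one vertex at a time. If the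
  factor of \<open>v\<close> is the difference \<open>D = h\<^sub>k - h'\<^sub>k\<close>, fix the colours of the edges not at \<open>v\<close>: since \<open>F\<close> is
  simple, every other factor depends on at most one edge at \<open>v\<close>, so the sum over the colours at \<open>v\<close>
  pairs \<open>D\<close> with a rank-one tensor and is at most \<open>\<parallel>D\<parallel>\<^sub>R\<close> times the norms of its components. These
  norms are again factors on \<open>F - v\<close>, and there a Cauchy--Schwarz inequality, applied edge by edge,
  bounds the remaining sum by the product of the \<open>\<ell>\<^sup>2\<close>-norms of the factors, which is at most \<open>1\<close>.
  These bounds are uniform over the finite sets of colours, hence they pass to an infinite \<open>C\<close>.\<close>

section \<open>Sums over colourings with finitely many colours\<close>

text \<open>A factor is a function of all colourings, so that it can be evaluated at colourings of
  any larger edge set; locality is recorded by this predicate instead of by the domain.\<close>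

definition depends_on :: "'e set \<Rightarrow> (('e \<Rightarrow> 'c) \<Rightarrow> real) \<Rightarrow> bool" where
  "depends_on A f \<longleftrightarrow> (\<forall>\<phi> \<psi>. (\<forall>e\<in>A. \<phi> e = \<psi> e) \<longrightarrow> f \<phi> = f \<psi>)"

lemma depends_onD: "depends_on A f \<Longrightarrow> (\<And>e. e \<in> A \<Longrightarrow> \<phi> e = \<psi> e) \<Longrightarrow> f \<phi> = f \<psi>"
  by (auto simp: depends_on_def)

text \<open>Fubini: \<open>override_on \<psi> \<eta> A\<close> glues a colouring of \<open>A\<close>
  to one of \<open>B\<close>, bijectively because \<open>A\<close> and \<open>B\<close> are
  disjoint.\<close>

lemma sum_PiE_Un:
  fixes F :: "('e \<Rightarrow> 'c) \<Rightarrow> real"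
  assumes "A \<inter> B = {}"
  shows "(\<Sum>\<phi>\<in>A \<union> B \<rightarrow>\<^sub>E C. F \<phi>) = (\<Sum>\<psi>\<in>B \<rightarrow>\<^sub>E C. \<Sum>\<eta>\<in>A \<rightarrow>\<^sub>E C. F (override_on \<psi> \<eta> A))"
proof -
  have "(\<Sum>(\<psi>, \<eta>)\<in>(B \<rightarrow>\<^sub>E C) \<times> (A \<rightarrow>\<^sub>E C). F (override_on \<psi> \<eta> A)) = (\<Sum>\<phi>\<in>A \<union> B \<rightarrow>\<^sub>E C. F \<phi>)"
    by (rule sum.reindex_bij_witness[where j = "\<lambda>(\<psi>, \<eta>). override_on \<psi> \<eta> A"
          and i = "\<lambda>\<phi>. (restrict \<phi> B, restrict \<phi> A)"])
      (use assms in \<open>auto simp: override_on_def PiE_def extensional_def fun_eq_iff Pi_def\<close>)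
  then show ?thesis by (simp add: sum.cartesian_product)
qed

lemma L2_set_PiE_singleton:
  "L2_set (\<lambda>\<eta>. g (override_on \<psi> \<eta> {e})) ({e} \<rightarrow>\<^sub>E C) = L2_set (\<lambda>c. g (\<psi>(e := c))) C"
proof -
  have "(\<Sum>\<eta>\<in>{e} \<rightarrow>\<^sub>E C. (g (override_on \<psi> \<eta> {e}))\<^sup>2) = (\<Sum>c\<in>C. (g (\<psi>(e := c)))\<^sup>2)"
    by (rule sum.reindex_bij_witness[where j = "\<lambda>\<eta>. \<eta> e" and i = "\<lambda>c. \<lambda>x\<in>{e}. c"])
      (auto simp: override_on_def PiE_def extensional_def fun_eq_iff Pi_def
        intro!: arg_cong[where f = "\<lambda>x. (g x)\<^sup>2"])
  then show ?thesis by (simp add: L2_set_def)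
qed

text \<open>The partial l2-norm in the colours of \<open>B\<close>, with all other colours frozen at
  \<psi>. It serves as the new factor once the edges in \<open>B\<close> have been summed
  out.\<close>

definition marginal :: "'c set \<Rightarrow> 'e set \<Rightarrow> (('e \<Rightarrow> 'c) \<Rightarrow> real) \<Rightarrow> ('e \<Rightarrow> 'c) \<Rightarrow> real" where
  "marginal C B f \<psi> = L2_set (\<lambda>\<eta>. f (override_on \<psi> \<eta> B)) (B \<rightarrow>\<^sub>E C)"

lemma marginal_nonneg: "0 \<le> marginal C B f \<psi>"
  by (simp add: marginal_def L2_set_nonneg)

lemma marginal_empty: "marginal C {} f \<psi> = \<bar>f \<psi>\<bar>"
  by (simp add: marginal_def L2_set_def)

lemma depends_on_marginal:
  assumes "depends_on A f"
  shows "depends_on (A - B) (marginal C (A \<inter> B) f)"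
  unfolding depends_on_def marginal_def
  by (intro allI impI L2_set_cong refl depends_onD[OF assms]) (auto simp: override_on_def)

text \<open>Iterating the norm loses nothing, so a bound by norms of marginals turns back into one
  by norms of the original factors.\<close>

lemma L2_set_marginal:
  "L2_set (marginal C (A \<inter> B) f) (A - B \<rightarrow>\<^sub>E C) = L2_set f (A \<rightarrow>\<^sub>E C)"
proof -
  have A: "A \<inter> B \<union> (A - B) = A" by blast
  have "(\<Sum>\<phi>\<in>A \<rightarrow>\<^sub>E C. (f \<phi>)\<^sup>2) = 
     (\<Sum>\<psi>\<in>A - B \<rightarrow>\<^sub>E C. \<Sum>\<eta>\<in>A \<inter> B \<rightarrow>\<^sub>E C. (f (override_on \<psi> \<eta> (A \<inter> B)))\<^sup>2)"
    using sum_PiE_Un[of "A \<inter> B" "A - B" "\<lambda>\<phi>. (f \<phi>)\<^sup>2" C] unfolding A by blast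
  then show ?thesis
    by (simp add: L2_set_def marginal_def sum_nonneg)
qed

text \<open>Induction on the edges. Only the two factors at the ends of \<open>e\<close> see its
  colour, so Cauchy--Schwarz over that colour replaces them by their marginals. All other factors
  come out of the sum as a nonnegative constant, and the marginals satisfy the hypotheses for the
  smaller edge set.\<close>

lemma sum_prod_le_prod_L2_set:
  fixes f :: "'v \<Rightarrow> ('e \<Rightarrow> 'c) \<Rightarrow> real"
  assumes "finite E" "finite V"
    and "\<And>v. v \<in> V \<Longrightarrow> A v \<subseteq> E"
    and "\<And>e. e \<in> E \<Longrightarrow> card {v \<in> V. e \<in> A v} = 2"
    and "\<And>v. v \<in> V \<Longrightarrow> depends_on (A v) (f v)"
    and "\<And>v \<phi>. v \<in> V \<Longrightarrow> 0 \<le> f v \<phi>"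
  shows "(\<Sum>\<phi>\<in>E \<rightarrow>\<^sub>E C. \<Prod>v\<in>V. f v \<phi>) \<le> (\<Prod>v\<in>V. L2_set (f v) (A v \<rightarrow>\<^sub>E C))"
  using assms(1,3-)
proof (induction E arbitrary: A f rule: finite_induct)
  case empty
  then have "A v = {}" if "v \<in> V" for v using that by blast
  then show ?case using empty by (simp add: L2_set_def prod_mono)
next
  case (insert e E)
  obtain u w where uw: "{v \<in> V. e \<in> A v} = {u, w}" "u \<noteq> w"
    using insert.prems(2)[of e] by (auto simp: card_2_iff)
  then have uwV: "u \<in> V" "w \<in> V" "e \<in> A u" "e \<in> A w" by blast+
  have other: "e \<notin> A v" if "v \<in> V - {u, w}" for v using that uw(1) by blast
  let ?g = "\<lambda>v. marginal C (A v \<inter> {e}) (f v)"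
  have V: "(\<Prod>v\<in>V. a v) = a u * a w * (\<Prod>v\<in>V - {u, w}. a v)" for a :: "'v \<Rightarrow> real"
    using prod.subset_diff[of "{u, w}" V a] uwV uw(2) assms(2) by simp
  have step: "(\<Sum>\<eta>\<in>{e} \<rightarrow>\<^sub>E C. \<Prod>v\<in>V. f v (override_on \<psi> \<eta> {e})) \<le> (\<Prod>v\<in>V. ?g v \<psi>)" for \<psi>
  proof -
    let ?P = "\<Prod>v\<in>V - {u, w}. f v \<psi>"
    have P: "(\<Prod>v\<in>V - {u, w}. f v (override_on \<psi> \<eta> {e})) = ?P" for \<eta>
    proof (intro prod.cong refl)
      fix v assume v: "v \<in> V - {u, w}"
      show "f v (override_on \<psi> \<eta> {e}) = f v \<psi>"
        using other[OF v] v by (intro depends_onD[OF insert.prems(3)]) (auto simp: override_on_def)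
    qed
    \<comment> \<open>Here \<open>A v \<inter> {e}\<close> is empty, so the marginal is the absolute
      value of \<open>f v\<close>, that is \<open>f v\<close> itself.\<close>
    have Pg: "?P = (\<Prod>v\<in>V - {u, w}. ?g v \<psi>)"
      using insert.prems(4) other by (intro prod.cong refl) (simp add: marginal_empty)
    have P0: "0 \<le> ?P" using insert.prems(4) by (intro prod_nonneg) auto
    have "(\<Sum>\<eta>\<in>{e} \<rightarrow>\<^sub>E C. \<Prod>v\<in>V. f v (override_on \<psi> \<eta> {e}))
        = (\<Sum>\<eta>\<in>{e} \<rightarrow>\<^sub>E C. \<bar>f u (override_on \<psi> \<eta> {e})\<bar> * \<bar>f w (override_on \<psi> \<eta> {e})\<bar>) * ?P"
      using insert.prems(4) uwV by (simp add: V P sum_distrib_right)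
    also have "\<dots> \<le> (?g u \<psi> * ?g w \<psi>) * ?P"
      using uwV by (intro mult_right_mono P0) (simp add: marginal_def L2_set_mult_ineq)
    finally show ?thesis by (simp add: V Pg)
  qed
  have "(\<Sum>\<phi>\<in>insert e E \<rightarrow>\<^sub>E C. \<Prod>v\<in>V. f v \<phi>)
      = (\<Sum>\<psi>\<in>E \<rightarrow>\<^sub>E C. \<Sum>\<eta>\<in>{e} \<rightarrow>\<^sub>E C. \<Prod>v\<in>V. f v (override_on \<psi> \<eta> {e}))"
    using sum_PiE_Un[of "{e}" E "\<lambda>\<phi>. \<Prod>v\<in>V. f v \<phi>" C] insert.hyps(2) by simp
  also have "\<dots> \<le> (\<Sum>\<psi>\<in>E \<rightarrow>\<^sub>E C. \<Prod>v\<in>V. ?g v \<psi>)"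
    by (intro sum_mono step)
  also have "\<dots> \<le> (\<Prod>v\<in>V. L2_set (?g v) (A v - {e} \<rightarrow>\<^sub>E C))"
  proof (rule insert.IH)
    show "A v - {e} \<subseteq> E" if "v \<in> V" for v using insert.prems(1)[OF that] by blast
    show "card {v \<in> V. x \<in> A v - {e}} = 2" if "x \<in> E" for x
    proof -
      have "{v \<in> V. x \<in> A v - {e}} = {v \<in> V. x \<in> A v}" using that insert.hyps(2) by auto
      then show ?thesis using insert.prems(2)[of x] that by simp
    qed
  qed (auto intro: depends_on_marginal marginal_nonneg insert.prems(3))
  also have "\<dots> = (\<Prod>v\<in>V. L2_set (f v) (A v \<rightarrow>\<^sub>E C))"
    by (simp add: L2_set_marginal)
  finally show ?case .
qed

text \<open>\<open>K\<close> stands for the seminorm of \<open>D\<close>, which keeps the argument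
  finite. The pairing bound removes \<open>v0\<close> and its edges at the price of turning
  neighbouring factors into marginals; what remains is a nonnegative sum to which
  \<open>sum_prod_le_prod_L2_set\<close> applies.\<close>

lemma abs_sum_vertex_le:
  fixes f :: "'v \<Rightarrow> ('e \<Rightarrow> 'c) \<Rightarrow> real"
  assumes fin: "finite E" "finite V" and v0: "v0 \<in> V"
    and sub: "\<And>v. v \<in> V \<Longrightarrow> A v \<subseteq> E"
    and two: "\<And>e. e \<in> E \<Longrightarrow> card {v \<in> V. e \<in> A v} = 2"
    and simple: "\<And>u e e'. u \<in> V - {v0} \<Longrightarrow> e \<in> A u \<inter> A v0 \<Longrightarrow> e' \<in> A u \<inter> A v0 \<Longrightarrow> e = e'"
    and dep: "\<And>v. v \<in> V - {v0} \<Longrightarrow> depends_on (A v) (f v)"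
    and depD: "depends_on (A v0) D"
    and K0: "0 \<le> K"
    and K: "\<And>r. \<bar>\<Sum>\<phi>\<in>A v0 \<rightarrow>\<^sub>E C. D \<phi> * (\<Prod>e\<in>A v0. r e (\<phi> e))\<bar> \<le> K * (\<Prod>e\<in>A v0. L2_set (r e) C)"
  shows "\<bar>\<Sum>\<phi>\<in>E \<rightarrow>\<^sub>E C. D \<phi> * (\<Prod>u\<in>V - {v0}. f u \<phi>)\<bar>
           \<le> K * (\<Prod>u\<in>V - {v0}. L2_set (f u) (A u \<rightarrow>\<^sub>E C))"
proof -
  let ?B = "A v0" and ?W = "V - {v0}"
  let ?g = "\<lambda>v. marginal C (A v \<inter> ?B) (f v)"
  have "\<exists>u. u \<noteq> v0 \<and> {v \<in> V. e \<in> A v} = {v0, u}" if "e \<in> ?B" for e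
  proof -
    have "e \<in> E" using that sub[OF v0] by blast
    then obtain a b where "{v \<in> V. e \<in> A v} = {a, b}" "a \<noteq> b"
      using two[of e] by (auto simp: card_2_iff)
    moreover have "v0 \<in> {v \<in> V. e \<in> A v}" using that v0 by simp
    ultimately show ?thesis by auto
  qed
  \<comment> \<open>\<open>nb e\<close> is the end of \<open>e\<close> other than
    \<open>v0\<close>.\<close>
  then obtain nb where nb: "\<And>e. e \<in> ?B \<Longrightarrow> nb e \<noteq> v0" "\<And>e. e \<in> ?B \<Longrightarrow> {v \<in> V. e \<in> A v} = {v0, nb e}"
    by metis
  then have nbV: "nb e \<in> ?W" "e \<in> A (nb e)" if "e \<in> ?B" for e
    using that by blast+
  have nb_eq: "u = nb e" if "e \<in> ?B" "u \<in> ?W" "e \<in> A u" for u e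
    using nb(2)[OF that(1)] that by blast
  \<comment> \<open>Two edges at \<open>v0\<close> never share their other end. Hence
    \<open>nb\<close> is injective, and the neighbouring factors can be indexed by the edges at
    \<open>v0\<close>.\<close>
  have nb_int: "A (nb e) \<inter> ?B = {e}" if "e \<in> ?B" for e
    using simple[OF nbV(1)[OF that]] nbV[OF that] that by blast
  have inj: "inj_on nb ?B"
    by (intro inj_onI) (metis nb_int singleton_inject)
  have split: "(\<Prod>u\<in>?W. a u) = (\<Prod>e\<in>?B. a (nb e)) * (\<Prod>u\<in>?W - nb ` ?B. a u)"
    for a :: "'v \<Rightarrow> real"
  proof -
    have "(\<Prod>u\<in>?W. a u) = (\<Prod>u\<in>nb ` ?B. a u) * (\<Prod>u\<in>?W - nb ` ?B. a u)"
      using fin nbV by (subst mult.commute, intro prod.subset_diff) auto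
    then show ?thesis using inj by (simp add: prod.reindex)
  qed
  have disj: "A u \<inter> ?B = {}" if "u \<in> ?W - nb ` ?B" for u
    using nb_eq that by blast
  have step: "\<bar>\<Sum>\<eta>\<in>?B \<rightarrow>\<^sub>E C. D (override_on \<psi> \<eta> ?B) * (\<Prod>u\<in>?W. f u (override_on \<psi> \<eta> ?B))\<bar>
      \<le> K * (\<Prod>u\<in>?W. ?g u \<psi>)" for \<psi>
  proof -
    let ?P = "\<Prod>u\<in>?W - nb ` ?B. f u \<psi>"
    \<comment> \<open>With the colours outside \<open>?B\<close> frozen, the factor at
      \<open>nb e\<close> depends on the colour of \<open>e\<close> alone, so these factors multiply
      to a rank-one tensor in the colours at \<open>v0\<close>.\<close>
    define r where "r = (\<lambda>e c. f (nb e) (\<psi>(e := c)))"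
    have r: "(\<Prod>e\<in>?B. f (nb e) (override_on \<psi> \<eta> ?B)) = (\<Prod>e\<in>?B. r e (\<eta> e))" for \<eta>
      unfolding r_def
    proof (intro prod.cong refl)
      fix e assume e: "e \<in> ?B"
      show "f (nb e) (override_on \<psi> \<eta> ?B) = f (nb e) (\<psi>(e := \<eta> e))"
        using nb_int[OF e] nbV[OF e] e
        by (intro depends_onD[OF dep]) (auto simp: override_on_def)
    qed
    have P: "(\<Prod>u\<in>?W - nb ` ?B. f u (override_on \<psi> \<eta> ?B)) = ?P" for \<eta>
    proof (intro prod.cong refl)
      fix u assume u: "u \<in> ?W - nb ` ?B"
      show "f u (override_on \<psi> \<eta> ?B) = f u \<psi>"
        using disj[OF u] u by (intro depends_onD[OF dep]) (auto simp: override_on_def)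
    qed
    have D: "D (override_on \<psi> \<eta> ?B) = D \<eta>" for \<eta>
      by (intro depends_onD[OF depD]) (auto simp: override_on_def)
    have Pg: "\<bar>?P\<bar> = (\<Prod>u\<in>?W - nb ` ?B. ?g u \<psi>)"
      using disj by (auto simp: abs_prod marginal_empty intro!: prod.cong)
    \<comment> \<open>The norms of the tensor components are exactly the marginals at the
      neighbours.\<close>
    have rg: "L2_set (r e) C = ?g (nb e) \<psi>" if "e \<in> ?B" for e
      by (simp add: nb_int[OF that] marginal_def L2_set_PiE_singleton r_def)
    have "(\<Sum>\<eta>\<in>?B \<rightarrow>\<^sub>E C. D (override_on \<psi> \<eta> ?B) * (\<Prod>u\<in>?W. f u (override_on \<psi> \<eta> ?B)))
        = (\<Sum>\<eta>\<in>?B \<rightarrow>\<^sub>E C. D \<eta> * (\<Prod>e\<in>?B. r e (\<eta> e))) * ?P"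
      by (simp add: split r P D sum_distrib_right mult.assoc)
    also have "\<bar>\<dots>\<bar> \<le> (K * (\<Prod>e\<in>?B. L2_set (r e) C)) * \<bar>?P\<bar>"
      unfolding abs_mult by (intro mult_right_mono K) auto
    also have "\<dots> = K * (\<Prod>u\<in>?W. ?g u \<psi>)"
      by (simp add: split Pg rg)
    finally show ?thesis .
  qed
  have E: "?B \<union> (E - ?B) = E" using sub[OF v0] by blast
  have "\<bar>\<Sum>\<phi>\<in>E \<rightarrow>\<^sub>E C. D \<phi> * (\<Prod>u\<in>?W. f u \<phi>)\<bar> =
     \<bar>\<Sum>\<psi>\<in>E - ?B \<rightarrow>\<^sub>E C. \<Sum>\<eta>\<in>?B \<rightarrow>\<^sub>E C.
        D (override_on \<psi> \<eta> ?B) * (\<Prod>u\<in>?W. f u (override_on \<psi> \<eta> ?B))\<bar>"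
    using sum_PiE_Un[of ?B "E - ?B" "\<lambda>\<phi>. D \<phi> * (\<Prod>u\<in>?W. f u \<phi>)" C] unfolding E by simp
  also have "\<dots> \<le> (\<Sum>\<psi>\<in>E - ?B \<rightarrow>\<^sub>E C. K * (\<Prod>u\<in>?W. ?g u \<psi>))"
    by (intro order.trans[OF sum_abs] sum_mono step)
  also have "\<dots> = K * (\<Sum>\<psi>\<in>E - ?B \<rightarrow>\<^sub>E C. \<Prod>u\<in>?W. ?g u \<psi>)"
    by (simp add: sum_distrib_left)
  also have "\<dots> \<le> K * (\<Prod>u\<in>?W. L2_set (?g u) (A u - ?B \<rightarrow>\<^sub>E C))"
  proof (intro mult_left_mono K0 sum_prod_le_prod_L2_set)
    show "A v - ?B \<subseteq> E - ?B" if "v \<in> ?W" for v using sub that by blast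
    \<comment> \<open>An edge not at \<open>v0\<close> has both its ends among the remaining
      vertices.\<close>
    show "card {v \<in> ?W. e \<in> A v - ?B} = 2" if "e \<in> E - ?B" for e
    proof -
      have "{v \<in> ?W. e \<in> A v - ?B} = {v \<in> V. e \<in> A v}" using that by auto
      then show ?thesis using two[of e] that by simp
    qed
  qed (auto intro: fin depends_on_marginal marginal_nonneg dep)
  also have "\<dots> = K * (\<Prod>u\<in>?W. L2_set (f u) (A u \<rightarrow>\<^sub>E C))"
    by (simp add: L2_set_marginal)
  finally show ?thesis .
qed

lemma depends_on_diff:
  "depends_on A f \<Longrightarrow> depends_on A g \<Longrightarrow> depends_on A (\<lambda>\<phi>. f \<phi> - g \<phi>)"
  unfolding depends_on_def by metis

text \<open>Telescoping: exchanging the factor at \<open>v\<close> costs at most \<open>K v\<close>,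
  because every other factor is an \<open>f\<close> or a \<open>g\<close> and has norm at most
  1.\<close>

lemma abs_sum_prod_diff_le:
  fixes f g :: "'v \<Rightarrow> ('e \<Rightarrow> 'c) \<Rightarrow> real"
  assumes fin: "finite E" "finite V"
    and sub: "\<And>v. v \<in> V \<Longrightarrow> A v \<subseteq> E"
    and two: "\<And>e. e \<in> E \<Longrightarrow> card {v \<in> V. e \<in> A v} = 2"
    and simple: "\<And>u v e e'. u \<in> V \<Longrightarrow> v \<in> V \<Longrightarrow> u \<noteq> v \<Longrightarrow>
                   e \<in> A u \<inter> A v \<Longrightarrow> e' \<in> A u \<inter> A v \<Longrightarrow> e = e'"
    and dep: "\<And>v. v \<in> V \<Longrightarrow> depends_on (A v) (f v)" "\<And>v. v \<in> V \<Longrightarrow> depends_on (A v) (g v)"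
    and norm: "\<And>v. v \<in> V \<Longrightarrow> L2_set (f v) (A v \<rightarrow>\<^sub>E C) \<le> 1"
      "\<And>v. v \<in> V \<Longrightarrow> L2_set (g v) (A v \<rightarrow>\<^sub>E C) \<le> 1"
    and K0: "\<And>v. v \<in> V \<Longrightarrow> 0 \<le> K v"
    and K: "\<And>v r. v \<in> V \<Longrightarrow>
      \<bar>\<Sum>\<phi>\<in>A v \<rightarrow>\<^sub>E C. (f v \<phi> - g v \<phi>) * (\<Prod>e\<in>A v. r e (\<phi> e))\<bar> \<le> K v * (\<Prod>e\<in>A v. L2_set (r e) C)"
  shows "\<bar>\<Sum>\<phi>\<in>E \<rightarrow>\<^sub>E C. (\<Prod>v\<in>V. f v \<phi>) - (\<Prod>v\<in>V. g v \<phi>)\<bar> \<le> (\<Sum>v\<in>V. K v)"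
proof -
  \<comment> \<open>hybrids, in which the vertices in \<open>T\<close> already carry \<open>g\<close>\<close>
  define z where "z = (\<lambda>T v. if v \<in> T then g v else f v)"
  have "\<bar>\<Sum>\<phi>\<in>E \<rightarrow>\<^sub>E C. (\<Prod>v\<in>V. f v \<phi>) - (\<Prod>v\<in>V. z T v \<phi>)\<bar> \<le> (\<Sum>v\<in>T. K v)"
    if "finite T" "T \<subseteq> V" for T
    using that
  proof (induction T)
    case empty
    then show ?case by (simp add: z_def)
  next
    case (insert v T)
    have v: "v \<in> V" "v \<notin> T" using insert by auto
    let ?D = "\<lambda>\<phi>. f v \<phi> - g v \<phi>"
    have "\<bar>\<Sum>\<phi>\<in>E \<rightarrow>\<^sub>E C. ?D \<phi> * (\<Prod>u\<in>V - {v}. z T u \<phi>)\<bar>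
        \<le> K v * (\<Prod>u\<in>V - {v}. L2_set (z T u) (A u \<rightarrow>\<^sub>E C))"
      by (rule abs_sum_vertex_le)
        (use fin v sub two simple K0 K dep in \<open>auto simp: z_def depends_on_diff\<close>)
    also have "\<dots> \<le> K v * 1"
      using norm K0[OF v(1)]
      by (intro mult_left_mono prod_le_1) (auto simp: z_def L2_set_nonneg)
    finally have 1: "\<bar>\<Sum>\<phi>\<in>E \<rightarrow>\<^sub>E C. ?D \<phi> * (\<Prod>u\<in>V - {v}. z T u \<phi>)\<bar> \<le> K v" by simp
    \<comment> \<open>The hybrids for \<open>T\<close> and \<open>insert v T\<close> differ only at
      \<open>v\<close>, where the first still carries \<open>f v\<close> since
      \<open>v \<notin> T\<close>.\<close>
    have eq: "(\<Prod>u\<in>V. f u \<phi>) - (\<Prod>u\<in>V. z (insert v T) u \<phi>)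
        = (\<Prod>u\<in>V. f u \<phi>) - (\<Prod>u\<in>V. z T u \<phi>) + ?D \<phi> * (\<Prod>u\<in>V - {v}. z T u \<phi>)" for \<phi>
    proof -
      have "(\<Prod>u\<in>V - {v}. z (insert v T) u \<phi>) = (\<Prod>u\<in>V - {v}. z T u \<phi>)"
        by (intro prod.cong) (auto simp: z_def)
      then show ?thesis
        using v fin by (simp add: prod.remove[of V v] left_diff_distrib) (simp add: z_def)
    qed
    have "(\<Sum>\<phi>\<in>E \<rightarrow>\<^sub>E C. (\<Prod>v\<in>V. f v \<phi>) - (\<Prod>u\<in>V. z (insert v T) u \<phi>)) =
        (\<Sum>\<phi>\<in>E \<rightarrow>\<^sub>E C. (\<Prod>v\<in>V. f v \<phi>) - (\<Prod>v\<in>V. z T v \<phi>))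
        + (\<Sum>\<phi>\<in>E \<rightarrow>\<^sub>E C. ?D \<phi> * (\<Prod>u\<in>V - {v}. z T u \<phi>))"
      unfolding eq by (rule sum.distrib)
    with 1 insert show ?case by auto
  qed
  from this[of V] fin show ?thesis by (simp add: z_def)
qed

section \<open>Summation over colourings and tuples\<close>

lemma has_sum_diff:
  fixes f g :: "'x \<Rightarrow> 'a :: real_normed_vector"
  assumes "(f has_sum a) X" "(g has_sum b) X"
  shows "((\<lambda>x. f x - g x) has_sum (a - b)) X"
  using has_sum_add[of f X a "\<lambda>x. - g x" "- b"] assms by (simp add: has_sum_uminus)

lemma summable_on_diff:
  fixes f g :: "'x \<Rightarrow> 'a :: real_normed_vector"
  shows "f summable_on X \<Longrightarrow> g summable_on X \<Longrightarrow> (\<lambda>x. f x - g x) summable_on X"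
  by (rule has_sum_imp_summable[OF has_sum_diff[OF has_sum_infsum has_sum_infsum]])

lemma infsum_diff:
  fixes f g :: "'x \<Rightarrow> 'a :: real_normed_vector"
  assumes "f summable_on X" "g summable_on X"
  shows "(\<Sum>\<^sub>\<infinity>x\<in>X. f x - g x) = infsum f X - infsum g X"
  by (intro infsumI has_sum_diff has_sum_infsum assms)

text \<open>Finitely many colourings of a finite edge set use finitely many colours. Hence the boxes
  over finite \<open>C0\<close> are cofinal among the finite sets of colourings.\<close>

lemma finite_subset_PiE_obtains_finite:
  assumes "finite X" "X \<subseteq> E \<rightarrow>\<^sub>E C" "finite E"
  obtains C0 where "finite C0" "C0 \<subseteq> C" "X \<subseteq> E \<rightarrow>\<^sub>E C0"
proof
  show "finite (\<Union>\<phi>\<in>X. \<phi> ` E)" using assms by auto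
  show "(\<Union>\<phi>\<in>X. \<phi> ` E) \<subseteq> C" using assms by (fastforce simp: PiE_def Pi_def)
  show "X \<subseteq> E \<rightarrow>\<^sub>E (\<Union>\<phi>\<in>X. \<phi> ` E)"
  proof
    fix \<phi> assume "\<phi> \<in> X"
    then show "\<phi> \<in> E \<rightarrow>\<^sub>E (\<Union>\<phi>\<in>X. \<phi> ` E)"
      using assms(2) by (intro PiE_I) auto
  qed
qed

lemma summable_on_PiE_if_bounded:
  fixes f :: "('e \<Rightarrow> 'c) \<Rightarrow> real"
  assumes "finite E"
    and bd: "\<And>C0. finite C0 \<Longrightarrow> C0 \<subseteq> C \<Longrightarrow> (\<Sum>\<phi>\<in>E \<rightarrow>\<^sub>E C0. \<bar>f \<phi>\<bar>) \<le> K"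
  shows "f summable_on (E \<rightarrow>\<^sub>E C)"
proof -
  have "(\<lambda>\<phi>. \<bar>f \<phi>\<bar>) summable_on (E \<rightarrow>\<^sub>E C)"
  proof (rule nonneg_bdd_above_summable_on)
    show "bdd_above (sum (\<lambda>\<phi>. \<bar>f \<phi>\<bar>) ` {F. F \<subseteq> E \<rightarrow>\<^sub>E C \<and> finite F})"
    proof (rule bdd_aboveI2)
      fix F assume "F \<in> {F. F \<subseteq> E \<rightarrow>\<^sub>E C \<and> finite F}"
      then obtain C0 where C0: "finite C0" "C0 \<subseteq> C" "F \<subseteq> E \<rightarrow>\<^sub>E C0"
        using finite_subset_PiE_obtains_finite[of F E C] assms(1) by auto
      then have "(\<Sum>\<phi>\<in>F. \<bar>f \<phi>\<bar>) \<le> (\<Sum>\<phi>\<in>E \<rightarrow>\<^sub>E C0. \<bar>f \<phi>\<bar>)"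
        using assms(1) by (intro sum_mono2 finite_PiE) auto
      also have "\<dots> \<le> K" using bd C0 by blast
      finally show "(\<Sum>\<phi>\<in>F. \<bar>f \<phi>\<bar>) \<le> K" .
    qed
  qed auto
  then show ?thesis using abs_summable_summable[of f] by simp
qed

text \<open>With the absolute value outside, the partial sums need not be monotone, so a supremum
  will not do. Instead the sum is approximated within \<epsilon> by a sum over a box, to which
  \<open>bd\<close> applies.\<close>

lemma abs_infsum_PiE_le:
  fixes f :: "('e \<Rightarrow> 'c) \<Rightarrow> real"
  assumes E: "finite E" and f: "f summable_on (E \<rightarrow>\<^sub>E C)"
    and bd: "\<And>C0. finite C0 \<Longrightarrow> C0 \<subseteq> C \<Longrightarrow> \<bar>\<Sum>\<phi>\<in>E \<rightarrow>\<^sub>E C0. f \<phi>\<bar> \<le> K"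
  shows "\<bar>\<Sum>\<^sub>\<infinity>\<phi>\<in>E \<rightarrow>\<^sub>E C. f \<phi>\<bar> \<le> K"
proof (rule field_le_epsilon)
  fix \<epsilon> :: real assume "\<epsilon> > 0"
  let ?s = "\<Sum>\<^sub>\<infinity>\<phi>\<in>E \<rightarrow>\<^sub>E C. f \<phi>"
  have "(sum f \<longlongrightarrow> ?s) (finite_subsets_at_top (E \<rightarrow>\<^sub>E C))"
    using has_sum_infsum[OF f] by (simp add: has_sum_def)
  then have "\<forall>\<^sub>F X in finite_subsets_at_top (E \<rightarrow>\<^sub>E C). dist (sum f X) ?s < \<epsilon>"
    using \<open>\<epsilon> > 0\<close> by (rule tendstoD)
  then obtain X where X: "finite X" "X \<subseteq> E \<rightarrow>\<^sub>E C"
    and close: "\<And>Y. finite Y \<and> X \<subseteq> Y \<and> Y \<subseteq> E \<rightarrow>\<^sub>E C \<Longrightarrow> dist (sum f Y) ?s < \<epsilon>"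
    unfolding eventually_finite_subsets_at_top by metis
  obtain C0 where C0: "finite C0" "C0 \<subseteq> C" "X \<subseteq> E \<rightarrow>\<^sub>E C0"
    using finite_subset_PiE_obtains_finite[OF X E] .
  have "dist (sum f (E \<rightarrow>\<^sub>E C0)) ?s < \<epsilon>"
    using C0 E by (intro close conjI finite_PiE PiE_mono) auto
  with bd[OF C0(1,2)] show "\<bar>?s\<bar> \<le> K + \<epsilon>"
    by (auto simp: dist_real_def)
qed

section \<open>Tuples as colourings of an enumerated edge set\<close>

lemma finite_tuples: "finite C \<Longrightarrow> finite (tuples C k)"
  unfolding tuples_def by (rule finite_subset[OF _ finite_lists_length_eq[of C k]]) auto

lemma tuples_mono: "C \<subseteq> D \<Longrightarrow> tuples C k \<subseteq> tuples D k"
  by (auto simp: tuples_def)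

lemma bij_betw_map_tuples:
  assumes "distinct es"
  shows "bij_betw (\<lambda>\<phi>. map \<phi> es) (set es \<rightarrow>\<^sub>E C) (tuples C (length es))"
proof (rule bij_betw_imageI)
  show "inj_on (\<lambda>\<phi>. map \<phi> es) (set es \<rightarrow>\<^sub>E C)"
    by (intro inj_onI) (rule PiE_ext, auto)
  have "cs \<in> (\<lambda>\<phi>. map \<phi> es) ` (set es \<rightarrow>\<^sub>E C)" if cs: "cs \<in> tuples C (length es)" for cs
  proof
    \<comment> \<open>The inverse reads the colour of an edge off the association list; distinctness
      of \<open>es\<close> makes the lookup return the entry at its position.\<close>
    let ?\<phi> = "\<lambda>e\<in>set es. the (map_of (zip es cs) e)"
    have len: "length cs = length es" and C: "set cs \<subseteq> C" using cs by (auto simp: tuples_def)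
    have *: "?\<phi> (es ! i) = cs ! i" if "i < length es" for i
      using that len assms by (simp add: map_of_zip_nth)
    show "cs = map ?\<phi> es"
      by (rule nth_equalityI) (simp_all add: len * del: restrict_apply)
    show "?\<phi> \<in> set es \<rightarrow>\<^sub>E C"
    proof (rule PiE_I)
      fix e assume "e \<in> set es"
      then obtain i where i: "i < length es" "e = es ! i" by (auto simp: in_set_conv_nth)
      then have "cs ! i \<in> C" using C len by (metis nth_mem subsetD)
      then show "?\<phi> e \<in> C" using *[OF i(1)] i(2) by simp
    qed simp
  qed
  then show "(\<lambda>\<phi>. map \<phi> es) ` (set es \<rightarrow>\<^sub>E C) = tuples C (length es)"
    by (auto simp: tuples_def)
qed

lemma sum_tuples:
  assumes "distinct es"
  shows "(\<Sum>\<phi>\<in>set es \<rightarrow>\<^sub>E C. F (map \<phi> es)) = (\<Sum>cs\<in>tuples C (length es). F cs)"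
  by (rule sum.reindex_bij_betw[OF bij_betw_map_tuples[OF assms]])

lemma sum_tuples_prod:
  fixes a :: "nat \<Rightarrow> 'c \<Rightarrow> real"
  assumes "finite C"
  shows "(\<Sum>cs\<in>tuples C k. \<Prod>i<k. a i (cs ! i)) = (\<Prod>i<k. \<Sum>c\<in>C. a i c)"
proof -
  have "(\<Prod>i<k. \<Sum>c\<in>C. a i c) = (\<Sum>\<phi>\<in>{..<k} \<rightarrow>\<^sub>E C. \<Prod>i<k. a i (\<phi> i))"
    using assms by (simp add: prod_sum_PiE)
  also have "\<dots> = (\<Sum>\<phi>\<in>set [0..<k] \<rightarrow>\<^sub>E C. \<Prod>i<k. a i (map \<phi> [0..<k] ! i))"
    by (simp add: atLeast0LessThan)
  also have "\<dots> = (\<Sum>cs\<in>tuples C k. \<Prod>i<k. a i (cs ! i))"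
    by (subst sum_tuples) auto
  finally show ?thesis ..
qed

section \<open>The seminorm defined by rank-one tensors\<close>

lemma ell2_ball_sum_le:
  assumes "f \<in> ell2 X" "ell2_norm X f \<le> 1" "finite Y" "Y \<subseteq> X"
  shows "(\<Sum>x\<in>Y. (f x)\<^sup>2) \<le> 1"
proof -
  have "(\<Sum>x\<in>Y. (f x)\<^sup>2) \<le> (\<Sum>\<^sub>\<infinity>x\<in>X. (f x)\<^sup>2)"
    using assms by (intro finite_sum_le_infsum) (auto simp: ell2_def)
  also have "\<dots> \<le> 1"
    using assms by (simp add: ell2_norm_def ell2_inner_def power2_eq_square)
  finally show ?thesis .
qed

text \<open>Enlarge \<open>F\<close> to the box of tuples over the finitely many entries that occur;
  there the sum of squares factors into one sum per component, each at most 1.\<close>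

lemma tensor_sum_squares_le:
  assumes "set rs \<subseteq> ell2_ball C" "finite F" "F \<subseteq> tuples C (length rs)"
  shows "(\<Sum>cs\<in>F. (tensor rs cs)\<^sup>2) \<le> 1"
proof -
  define C0 where "C0 = (\<Union>cs\<in>F. set cs)"
  have C0: "finite C0" "C0 \<subseteq> C" "F \<subseteq> tuples C0 (length rs)"
    using assms by (auto simp: C0_def tuples_def)
  have "(\<Sum>cs\<in>F. (tensor rs cs)\<^sup>2) \<le> (\<Sum>cs\<in>tuples C0 (length rs). (tensor rs cs)\<^sup>2)"
    using C0 finite_tuples by (intro sum_mono2) auto
  also have "\<dots> = (\<Sum>cs\<in>tuples C0 (length rs). \<Prod>i<length rs. ((rs ! i) (cs ! i))\<^sup>2)"
    by (intro sum.cong) (auto simp: tensor_def tuples_def prod_power_distrib)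
  also have "\<dots> = (\<Prod>i<length rs. \<Sum>c\<in>C0. ((rs ! i) c)\<^sup>2)"
    using sum_tuples_prod[OF C0(1), where k = "length rs" and a = "\<lambda>i c. ((rs ! i) c)\<^sup>2"] by simp
  also have "\<dots> \<le> 1"
  proof (intro prod_le_1 conjI sum_nonneg)
    fix i assume "i \<in> {..<length rs}"
    then have "rs ! i \<in> ell2_ball C" using assms(1) by (auto simp: subset_iff)
    then show "(\<Sum>c\<in>C0. ((rs ! i) c)\<^sup>2) \<le> 1"
      using C0 by (intro ell2_ball_sum_le) (auto simp: ell2_ball_def)
  qed auto
  finally show ?thesis .
qed

text \<open>The pointwise bound of the product by the sum of squares replaces Cauchy--Schwarz: all
  that is needed is convergence and a bound uniform over rank-one tensors.\<close>

lemma ell2_mult_summable: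
  fixes f g :: "'x \<Rightarrow> real"
  assumes "(\<lambda>x. (f x)\<^sup>2) summable_on X" "(\<lambda>x. (g x)\<^sup>2) summable_on X"
  shows "(\<lambda>x. f x * g x) summable_on X"
    and "\<bar>\<Sum>\<^sub>\<infinity>x\<in>X. f x * g x\<bar> \<le> (\<Sum>\<^sub>\<infinity>x\<in>X. (f x)\<^sup>2) + (\<Sum>\<^sub>\<infinity>x\<in>X. (g x)\<^sup>2)"
proof -
  have le: "\<bar>f x * g x\<bar> \<le> (f x)\<^sup>2 + (g x)\<^sup>2" for x
  proof -
    have "2 * (\<bar>f x\<bar> * \<bar>g x\<bar>) \<le> (f x)\<^sup>2 + (g x)\<^sup>2"
      using sum_squares_bound[of "\<bar>f x\<bar>" "\<bar>g x\<bar>"] by simp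
    moreover have "0 \<le> \<bar>f x\<bar> * \<bar>g x\<bar>" by simp
    ultimately show ?thesis unfolding abs_mult by linarith
  qed
  have sq: "(\<lambda>x. (f x)\<^sup>2 + (g x)\<^sup>2) summable_on X"
    using assms by (rule summable_on_add)
  have abs: "(\<lambda>x. norm (f x * g x)) summable_on X"
    using le by (intro Infinite_Sum.abs_summable_on_comparison_test'[OF sq]) auto
  then show "(\<lambda>x. f x * g x) summable_on X"
    by (rule abs_summable_summable)
  have "norm (\<Sum>\<^sub>\<infinity>x\<in>X. f x * g x) \<le> (\<Sum>\<^sub>\<infinity>x\<in>X. norm (f x * g x))"
    by (rule norm_infsum_bound[OF abs])
  also have "\<dots> \<le> (\<Sum>\<^sub>\<infinity>x\<in>X. (f x)\<^sup>2 + (g x)\<^sup>2)"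
    using le by (intro infsum_mono abs sq) auto
  finally show "\<bar>\<Sum>\<^sub>\<infinity>x\<in>X. f x * g x\<bar> \<le> (\<Sum>\<^sub>\<infinity>x\<in>X. (f x)\<^sup>2) + (\<Sum>\<^sub>\<infinity>x\<in>X. (g x)\<^sup>2)"
    using assms by (simp add: infsum_add)
qed

lemma rank_one_squares:
  assumes "r \<in> rank_one C k"
  shows "(\<lambda>x. (r x)\<^sup>2) summable_on tuples C k" "(\<Sum>\<^sub>\<infinity>x\<in>tuples C k. (r x)\<^sup>2) \<le> 1"
proof -
  have le: "(\<Sum>x\<in>F. (r x)\<^sup>2) \<le> 1" if "finite F" "F \<subseteq> tuples C k" for F
    using assms tensor_sum_squares_le that by (auto simp: rank_one_def)
  show summ: "(\<lambda>x. (r x)\<^sup>2) summable_on tuples C k"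
    using le by (intro nonneg_bdd_above_summable_on bdd_aboveI2[where M = 1]) auto
  show "(\<Sum>\<^sub>\<infinity>x\<in>tuples C k. (r x)\<^sup>2) \<le> 1"
    using le by (intro infsum_le_finite_sums[OF summ]) auto
qed

lemma ell2_diff:
  assumes "f \<in> ell2 X" "g \<in> ell2 X"
  shows "(\<lambda>x. f x - g x) \<in> ell2 X"
proof -
  have "(\<lambda>x. (f x)\<^sup>2 + (g x)\<^sup>2 - 2 * (f x * g x)) summable_on X"
    using assms by (intro summable_on_diff summable_on_add summable_on_cmult_right ell2_mult_summable(1))
      (auto simp: ell2_def)
  then show ?thesis
    using assms by (simp add: ell2_def power2_diff mult.assoc)
qed

text \<open>The real supremum over an empty set carries no information, so this is needed for
  nonnegativity and for bounding the seminorm from above. For \<open>k = 0\<close> the witness is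
  \<open>tensor []\<close>, with value 1 at \<open>[]\<close>.\<close>

lemma rank_one_nonempty: "rank_one C k \<noteq> {}"
proof -
  have "(\<lambda>_. 0) \<in> ell2_ball C"
    by (simp add: ell2_ball_def ell2_def ell2_norm_def ell2_inner_def)
  then have "tensor (replicate k (\<lambda>_. 0)) \<in> rank_one C k"
    by (auto simp: rank_one_def)
  then show ?thesis by blast
qed

lemma bdd_above_rank_one:
  assumes "h \<in> ell2 (tuples C k)"
  shows "bdd_above ((\<lambda>r. \<bar>ell2_inner (tuples C k) r h\<bar>) ` rank_one C k)"
proof (rule bdd_aboveI2)
  fix r assume r: "r \<in> rank_one C k"
  have "\<bar>ell2_inner (tuples C k) r h\<bar>
      \<le> (\<Sum>\<^sub>\<infinity>x\<in>tuples C k. (r x)\<^sup>2) + (\<Sum>\<^sub>\<infinity>x\<in>tuples C k. (h x)\<^sup>2)"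
    unfolding ell2_inner_def using assms rank_one_squares(1)[OF r]
    by (intro ell2_mult_summable) (auto simp: ell2_def)
  then show "\<bar>ell2_inner (tuples C k) r h\<bar> \<le> 1 + (\<Sum>\<^sub>\<infinity>x\<in>tuples C k. (h x)\<^sup>2)"
    using rank_one_squares(2)[OF r] by linarith
qed

lemma ell2_inner_le_seminorm:
  assumes "h \<in> ell2 (tuples C k)" "r \<in> rank_one C k"
  shows "\<bar>ell2_inner (tuples C k) r h\<bar> \<le> ell2_seminorm (tuples C k) (rank_one C k) h"
  unfolding ell2_seminorm_def using assms by (intro cSUP_upper bdd_above_rank_one)

lemma ell2_seminorm_nonneg:
  assumes "h \<in> ell2 (tuples C k)"
  shows "0 \<le> ell2_seminorm (tuples C k) (rank_one C k) h"
proof -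
  obtain r where "r \<in> rank_one C k" using rank_one_nonempty by blast
  from ell2_inner_le_seminorm[OF assms this] show ?thesis by linarith
qed

lemma ell2_dist_self: "ell2_dist (tuples C k) (rank_one C k) f f = 0"
  by (simp add: ell2_dist_def ell2_seminorm_def ell2_inner_def rank_one_nonempty)

text \<open>Pairing with a fixed rank-one tensor is additive, as the series converge. The inequality
  is what makes the balls of the pseudometric open.\<close>

lemma ell2_dist_triangle:
  assumes f: "f \<in> ell2 (tuples C k)" and g: "g \<in> ell2 (tuples C k)" and h: "h \<in> ell2 (tuples C k)"
  defines "d \<equiv> ell2_dist (tuples C k) (rank_one C k)"
  shows "d f h \<le> d f g + d g h"
proof -
  let ?X = "tuples C k"
  have "\<bar>ell2_inner ?X r (\<lambda>x. f x - h x)\<bar> \<le> d f g + d g h" if r: "r \<in> rank_one C k" for r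
  proof -
    have summ: "(\<lambda>x. r x * (a x - b x)) summable_on ?X" if "a \<in> ell2 ?X" "b \<in> ell2 ?X" for a b
      using ell2_diff[OF that] by (intro ell2_mult_summable rank_one_squares[OF r]) (simp add: ell2_def)
    have "ell2_inner ?X r (\<lambda>x. f x - h x)
        = (\<Sum>\<^sub>\<infinity>x\<in>?X. r x * (f x - g x) + r x * (g x - h x))"
      unfolding ell2_inner_def by (intro infsum_cong) (simp add: algebra_simps)
    also have "\<dots> = ell2_inner ?X r (\<lambda>x. f x - g x) + ell2_inner ?X r (\<lambda>x. g x - h x)"
      unfolding ell2_inner_def by (intro infsum_add summ f g h)
    finally show ?thesis
      using ell2_inner_le_seminorm[OF ell2_diff[OF f g] r]
        ell2_inner_le_seminorm[OF ell2_diff[OF g h] r]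
      by (simp add: d_def ell2_dist_def)
  qed
  then show ?thesis
    unfolding d_def ell2_dist_def ell2_seminorm_def[of ?X _ "\<lambda>x. f x - h x"]
    by (intro cSUP_least rank_one_nonempty)
qed

text \<open>This supplies the pairing bound for arbitrary components \<open>r e\<close>: by
  homogeneity they may be scaled to unit vectors, which form an element of
  \<open>rank_one\<close>.\<close>

lemma abs_sum_rank_one_le:
  fixes r :: "'e \<Rightarrow> 'c \<Rightarrow> real"
  assumes h: "h \<in> ell2 (tuples C (length es))" and es: "distinct es"
    and C0: "finite C0" "C0 \<subseteq> C"
  shows "\<bar>\<Sum>\<phi>\<in>set es \<rightarrow>\<^sub>E C0. h (map \<phi> es) * (\<Prod>e\<in>set es. r e (\<phi> e))\<bar>
     \<le> ell2_seminorm (tuples C (length es)) (rank_one C (length es)) h * (\<Prod>e\<in>set es. L2_set (r e) C0)"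
    (is "\<bar>?S\<bar> \<le> ?K * ?N")
proof (cases "\<exists>e\<in>set es. L2_set (r e) C0 = 0")
  \<comment> \<open>A component that vanishes on \<open>C0\<close> cannot be normalised, but then
    both sides are 0.\<close>
  case True
  then obtain e where e: "e \<in> set es" "L2_set (r e) C0 = 0" by blast
  then have "r e c = 0" if "c \<in> C0" for c
    using that C0 by (simp add: L2_set_eq_0_iff)
  then have "(\<Prod>e\<in>set es. r e (\<phi> e)) = 0" if "\<phi> \<in> set es \<rightarrow>\<^sub>E C0" for \<phi>
    using that e by (auto intro!: prod_zero)
  then have "?S = 0" by (intro sum.neutral) simp
  moreover have "?N = 0" using e by (auto intro!: prod_zero)
  ultimately show ?thesis by (simp only: abs_zero mult_zero_right order.refl)
next
  case False
  have pos: "L2_set (r e) C0 > 0" if "e \<in> set es" for e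
  proof -
    have "L2_set (r e) C0 \<noteq> 0" using False that by blast
    then show ?thesis using L2_set_nonneg[of "r e" C0] by linarith
  qed
  \<comment> \<open>Extension by 0 puts \<open>s e\<close> into the unit ball over \<open>C\<close>,
    whatever \<open>r e\<close> does outside \<open>C0\<close>.\<close>
  define s where "s = (\<lambda>e c. if c \<in> C0 then r e c / L2_set (r e) C0 else 0)"
  let ?X = "tuples C (length es)" and ?Y = "tuples C0 (length es)"
  have "s e \<in> ell2_ball C" if "e \<in> set es" for e
  proof -
    have "((\<lambda>c. (s e c)\<^sup>2) has_sum (\<Sum>c\<in>C0. (s e c)\<^sup>2)) C"
      using C0 by (intro has_sum_finite_neutralI) (auto simp: s_def)
    moreover have "(\<Sum>c\<in>C0. (s e c)\<^sup>2) = 1"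
    proof -
      have N: "(\<Sum>c\<in>C0. (r e c)\<^sup>2) = (L2_set (r e) C0)\<^sup>2"
        by (simp add: L2_set_def sum_nonneg)
      have "(\<Sum>c\<in>C0. (s e c)\<^sup>2) = (\<Sum>c\<in>C0. (r e c)\<^sup>2) / (L2_set (r e) C0)\<^sup>2"
        by (simp add: s_def power_divide sum_divide_distrib)
      also have "\<dots> = 1" unfolding N using pos[OF that] by simp
      finally show ?thesis .
    qed
    ultimately have "((\<lambda>c. (s e c)\<^sup>2) has_sum 1) C" by simp
    then show ?thesis
      using C0 by (auto simp: ell2_ball_def ell2_def ell2_norm_def ell2_inner_def
          power2_eq_square[symmetric] infsumI summable_on_def s_def)
  qed
  then have t: "tensor (map s es) \<in> rank_one C (length es)"
    by (auto simp: rank_one_def intro!: exI[of _ "map s es"])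
  \<comment> \<open>This reduces the inner product over all tuples to a finite sum over
    \<open>?Y\<close>.\<close>
  have tensor0: "tensor (map s es) cs = 0" if "cs \<in> ?X - ?Y" for cs
  proof -
    have "length cs = length es" "\<not> set cs \<subseteq> C0" using that by (auto simp: tuples_def)
    then obtain i where "i < length es" "cs ! i \<notin> C0"
      by (metis in_set_conv_nth subsetI)
    then show ?thesis by (auto simp: tensor_def s_def intro!: prod_zero)
  qed
  \<comment> \<open>Multiplying by \<open>?N\<close> undoes the normalisation.\<close>
  have tensor: "tensor (map s es) (map \<phi> es) * ?N = (\<Prod>e\<in>set es. r e (\<phi> e))"
    if "\<phi> \<in> set es \<rightarrow>\<^sub>E C0" for \<phi>
  proof -
    have "tensor (map s es) (map \<phi> es) = (\<Prod>i<length es. s (es ! i) (\<phi> (es ! i)))"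
      by (auto simp: tensor_def)
    also have "\<dots> = (\<Prod>e\<in>set es. s e (\<phi> e))"
      using bij_betw_nth[OF es refl refl] by (rule prod.reindex_bij_betw)
    finally have "tensor (map s es) (map \<phi> es) * ?N
        = (\<Prod>e\<in>set es. s e (\<phi> e) * L2_set (r e) C0)"
      by (simp add: prod.distrib)
    also have "\<dots> = (\<Prod>e\<in>set es. r e (\<phi> e))"
      using that pos by (intro prod.cong) (force simp: s_def)+
    finally show ?thesis .
  qed
  have N0: "0 \<le> ?N" by (intro prod_nonneg ballI L2_set_nonneg)
  have "ell2_inner ?X (tensor (map s es)) h = (\<Sum>cs\<in>?Y. tensor (map s es) cs * h cs)"
    unfolding ell2_inner_def using C0 tensor0 tuples_mono[OF C0(2)] finite_tuples[OF C0(1)]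
    by (intro infsumI has_sum_finite_neutralI) auto
  also have "\<dots> = (\<Sum>\<phi>\<in>set es \<rightarrow>\<^sub>E C0. tensor (map s es) (map \<phi> es) * h (map \<phi> es))"
    by (simp add: sum_tuples[OF es, where F = "\<lambda>cs. tensor (map s es) cs * h cs"])
  finally have "ell2_inner ?X (tensor (map s es)) h * ?N
     = (\<Sum>\<phi>\<in>set es \<rightarrow>\<^sub>E C0. (tensor (map s es) (map \<phi> es) * ?N) * h (map \<phi> es))"
    by (simp add: sum_distrib_left sum_distrib_right mult_ac)
  also have "\<dots> = ?S"
    by (intro sum.cong refl) (simp add: tensor)
  finally have "\<bar>?S\<bar> = \<bar>ell2_inner ?X (tensor (map s es)) h\<bar> * ?N"
    by (metis (no_types) N0 abs_mult abs_of_nonneg)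
  also have "\<dots> \<le> ?K * ?N"
    by (intro mult_right_mono ell2_inner_le_seminorm h t N0)
  finally show ?thesis .
qed

section \<open>Lipschitz continuity of the partition function\<close>

lemma edge_order:
  assumes "F \<in> simple_graphs"
  shows "distinct (edge_order F v)" "set (edge_order F v) = incident_edges F v"
    "length (edge_order F v) = vertex_degree F v"
proof -
  obtain V E where F: "F = (V, E)" "finite V" "E \<subseteq> {e. e \<subseteq> V \<and> card e = 2}"
    using assms by (auto simp: simple_graphs_def)
  then have "finite E"
    by (auto intro: finite_subset[OF _ finite_Collect_subsets[of V]])
  then have "finite (incident_edges F v)" by (simp add: incident_edges_def F)
  then have "\<exists>es. distinct es \<and> set es = incident_edges F v"
    using finite_distinct_list by metis
  then have *: "distinct (edge_order F v) \<and> set (edge_order F v) = incident_edges F v"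
    unfolding edge_order_def by (rule someI_ex)
  then show "distinct (edge_order F v)" "set (edge_order F v) = incident_edges F v" by auto
  with distinct_card[of "edge_order F v"] show "length (edge_order F v) = vertex_degree F v"
    by (simp add: vertex_degree_def)
qed

definition vertex_factor ::
    "(nat \<Rightarrow> 'c list \<Rightarrow> real) \<Rightarrow> 'v sgraph \<Rightarrow> 'v \<Rightarrow> ('v set \<Rightarrow> 'c) \<Rightarrow> real" where
  "vertex_factor h F v \<phi> = h (vertex_degree F v) (map \<phi> (edge_order F v))"

lemma depends_on_vertex_factor:
  fixes F :: "'v sgraph" and h :: "nat \<Rightarrow> 'c list \<Rightarrow> real"
  assumes "F \<in> simple_graphs"
  shows "depends_on (incident_edges F v) (vertex_factor h F v)"
proof -
  have "map \<phi> (edge_order F v) = map \<psi> (edge_order F v)"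
    if "\<forall>e\<in>incident_edges F v. \<phi> e = \<psi> e" for \<phi> \<psi> :: "'v set \<Rightarrow> 'c"
    using that by (simp add: edge_order(2)[OF assms])
  then show ?thesis unfolding depends_on_def vertex_factor_def by metis
qed

text \<open>Through the enumeration of the incident edges, this norm is that of \<open>h\<close>
  restricted to tuples over \<open>C0\<close>.\<close>

lemma L2_set_vertex_factor_le_1:
  assumes F: "F \<in> simple_graphs" and h: "h (vertex_degree F v) \<in> sym_ball C (vertex_degree F v)"
    and C0: "finite C0" "C0 \<subseteq> C"
  shows "L2_set (vertex_factor h F v) (incident_edges F v \<rightarrow>\<^sub>E C0) \<le> 1"
proof -
  let ?k = "vertex_degree F v"
  have "(\<Sum>\<phi>\<in>incident_edges F v \<rightarrow>\<^sub>E C0. (vertex_factor h F v \<phi>)\<^sup>2) = (\<Sum>cs\<in>tuples C0 ?k. (h ?k cs)\<^sup>2)"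
    unfolding vertex_factor_def edge_order(2)[OF F, symmetric] edge_order(3)[OF F, symmetric]
    by (rule sum_tuples[OF edge_order(1)[OF F]])
  also have "\<dots> \<le> 1"
    using h C0 by (intro ell2_ball_sum_le[of _ "tuples C ?k"] finite_tuples tuples_mono)
      (auto simp: sym_ball_def sym_ell2_def)
  finally show ?thesis by (simp add: L2_set_def)
qed

section \<open>Estimates for a fixed graph\<close>

context
  fixes C :: "'c set" and F :: "'v sgraph" and V E
  assumes F: "F \<in> simple_graphs" and FVE: "F = (V, E)"
begin

lemma finite_vertices: "finite V"
  and finite_edges: "finite E"
  and edge_subset: "e \<in> E \<Longrightarrow> e \<subseteq> V"
  and edge_card: "e \<in> E \<Longrightarrow> card e = 2"
  using F FVE finite_subset[of E "Pow V"] by (auto simp: simple_graphs_def)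

lemma incident_edges_subset: "incident_edges F v \<subseteq> E"
  by (auto simp: incident_edges_def FVE)

lemma two_endpoints: "e \<in> E \<Longrightarrow> card {v \<in> V. e \<in> incident_edges F v} = 2"
proof -
  assume e: "e \<in> E"
  then have "{v \<in> V. e \<in> incident_edges F v} = e"
    using edge_subset by (auto simp: incident_edges_def FVE)
  then show ?thesis using edge_card[OF e] by simp
qed

text \<open>Absence of parallel edges: an edge at both \<open>u\<close> and \<open>v\<close> has two
  elements and so equals \<open>{u, v}\<close>.\<close>

lemma common_edge_unique:
  assumes "u \<noteq> v" "e \<in> incident_edges F u \<inter> incident_edges F v"
    "e' \<in> incident_edges F u \<inter> incident_edges F v"
  shows "e = e'"
proof -
  have "x = {u, v}" if "x \<in> incident_edges F u \<inter> incident_edges F v" for x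
    using that assms(1) edge_card[of x] by (auto simp: incident_edges_def FVE card_2_iff)
  then show ?thesis using assms by metis
qed

text \<open>Absolute values of the factors keep the same norms, so the nonnegative product bound
  gives 1 on every finite box.\<close>

lemma summable_partition:
  assumes h: "\<And>k. h k \<in> sym_ball C k"
  shows "(\<lambda>\<phi>. \<Prod>v\<in>V. vertex_factor h F v \<phi>) summable_on (E \<rightarrow>\<^sub>E C)"
proof (rule summable_on_PiE_if_bounded[OF finite_edges])
  fix C0 assume C0: "finite C0" "C0 \<subseteq> C"
  let ?f = "\<lambda>v \<phi>. \<bar>vertex_factor h F v \<phi>\<bar>"
  have "(\<Sum>\<phi>\<in>E \<rightarrow>\<^sub>E C0. \<bar>\<Prod>v\<in>V. vertex_factor h F v \<phi>\<bar>) = (\<Sum>\<phi>\<in>E \<rightarrow>\<^sub>E C0. \<Prod>v\<in>V. ?f v \<phi>)"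
    by (simp add: abs_prod)
  also have "\<dots> \<le> (\<Prod>v\<in>V. L2_set (?f v) (incident_edges F v \<rightarrow>\<^sub>E C0))"
    using depends_on_vertex_factor[OF F, of _ h]
    by (intro sum_prod_le_prod_L2_set finite_edges finite_vertices incident_edges_subset two_endpoints)
      (auto simp: depends_on_def intro!: arg_cong[where f = abs])
  also have "\<dots> \<le> 1"
    using L2_set_vertex_factor_le_1[OF F _ C0, of h] h
    by (intro prod_le_1 conjI L2_set_nonneg) (simp add: L2_set_def)
  finally show "(\<Sum>\<phi>\<in>E \<rightarrow>\<^sub>E C0. \<bar>\<Prod>v\<in>V. vertex_factor h F v \<phi>\<bar>) \<le> 1" .
qed

text \<open>The exchange bound with \<open>K v = ?d v\<close> is independent of \<open>C0\<close>
  and so passes to the infinite sum.\<close>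

lemma partition_map_lipschitz:
  assumes h: "\<And>k. h k \<in> sym_ball C k" and h': "\<And>k. h' k \<in> sym_ball C k"
  shows "\<bar>partition_map C h F - partition_map C h' F\<bar>
     \<le> (\<Sum>v\<in>V. ell2_dist (tuples C (vertex_degree F v)) (rank_one C (vertex_degree F v))
            (h (vertex_degree F v)) (h' (vertex_degree F v)))"
    (is "_ \<le> (\<Sum>v\<in>V. ?d v)")
proof -
  let ?p = "\<lambda>h \<phi>. \<Prod>v\<in>V. vertex_factor h F v \<phi>"
  have pm: "partition_map C g F = (\<Sum>\<^sub>\<infinity>\<phi>\<in>E \<rightarrow>\<^sub>E C. ?p g \<phi>)" for g
    using F by (simp add: partition_map_def FVE vertex_factor_def)
  have ell2: "(\<lambda>x. h k x - h' k x) \<in> ell2 (tuples C k)" for k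
    using h[of k] h'[of k] by (intro ell2_diff) (auto simp: sym_ball_def sym_ell2_def)
  have summ: "(\<lambda>\<phi>. ?p h \<phi> - ?p h' \<phi>) summable_on (E \<rightarrow>\<^sub>E C)"
    by (intro summable_on_diff summable_partition h h')
  have "partition_map C h F - partition_map C h' F = (\<Sum>\<^sub>\<infinity>\<phi>\<in>E \<rightarrow>\<^sub>E C. ?p h \<phi> - ?p h' \<phi>)"
    unfolding pm by (intro infsum_diff[symmetric] summable_partition h h')
  also have "\<bar>\<dots>\<bar> \<le> (\<Sum>v\<in>V. ?d v)"
  proof (rule abs_infsum_PiE_le[OF finite_edges summ])
    fix C0 assume C0: "finite C0" "C0 \<subseteq> C"
    have norm: "L2_set (vertex_factor g F v) (incident_edges F v \<rightarrow>\<^sub>E C0) \<le> 1"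
      if "\<And>k. g k \<in> sym_ball C k" for g v
      using that by (rule L2_set_vertex_factor_le_1[OF F _ C0])
    show "\<bar>\<Sum>\<phi>\<in>E \<rightarrow>\<^sub>E C0. ?p h \<phi> - ?p h' \<phi>\<bar> \<le> (\<Sum>v\<in>V. ?d v)"
    proof (rule abs_sum_prod_diff_le[where A = "incident_edges F"])
      show "0 \<le> ?d v" for v
        unfolding ell2_dist_def by (rule ell2_seminorm_nonneg[OF ell2])
      show "\<bar>\<Sum>\<phi>\<in>incident_edges F v \<rightarrow>\<^sub>E C0. (vertex_factor h F v \<phi> - vertex_factor h' F v \<phi>) *
               (\<Prod>e\<in>incident_edges F v. r e (\<phi> e))\<bar>
          \<le> ?d v * (\<Prod>e\<in>incident_edges F v. L2_set (r e) C0)" for v and r :: "'v set \<Rightarrow> 'c \<Rightarrow> real"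
        using abs_sum_rank_one_le[OF ell2 edge_order(1)[OF F] C0, of v r]
        by (simp add: edge_order(2,3)[OF F] vertex_factor_def ell2_dist_def)
    qed (simp_all add: finite_edges finite_vertices incident_edges_subset two_endpoints
        depends_on_vertex_factor F norm h h' | erule common_edge_unique; blast)+
  qed
  finally show ?thesis .
qed

end

section \<open>Continuity for the product topology\<close>

lemma topspace_sym_ball_topology: "topspace (sym_ball_topology C k) = sym_ball C k"
  by (simp add: sym_ball_topology_def topspace_pseudometric_topology)

lemma openin_sym_ball:
  assumes x: "x \<in> sym_ball C k"
  shows "openin (sym_ball_topology C k)
    {y \<in> sym_ball C k. ell2_dist (tuples C k) (rank_one C k) x y < \<epsilon>}"
  unfolding sym_ball_topology_def openin_pseudometric_topology
proof (intro conjI ballI)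
  let ?d = "ell2_dist (tuples C k) (rank_one C k)"
  fix y assume y: "y \<in> {y \<in> sym_ball C k. ?d x y < \<epsilon>}"
  have "?d x z < \<epsilon>" if "z \<in> sym_ball C k" "?d y z < \<epsilon> - ?d x y" for z
    using ell2_dist_triangle[of x C k y z] that x y by (auto simp: sym_ball_def sym_ell2_def)
  with y show "\<exists>\<delta>>0. \<forall>z\<in>sym_ball C k. ?d y z < \<delta> \<longrightarrow> z \<in> {y \<in> sym_ball C k. ?d x y < \<epsilon>}"
    by (intro exI[of _ "\<epsilon> - ?d x y"]) auto
qed auto

text \<open>The Lipschitz bound involves only the coordinates \<open>k\<close> that are degrees of
  \<open>F\<close>. These are finitely many, so controlling them is an open condition in the product
  topology.\<close>

lemma continuous_map_partition_map_component:
  fixes C :: "'c set"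
  assumes F: "F \<in> simple_graphs"
  shows "continuous_map (product_topology (sym_ball_topology C) UNIV) euclideanreal
           (\<lambda>h. partition_map C h F)"
proof -
  obtain V E where VE: "F = (V, E)" by (cases F)
  have fin: "finite V" using F VE by (auto simp: simple_graphs_def)
  let ?T = "product_topology (sym_ball_topology C) (UNIV :: nat set)"
  let ?d = "\<lambda>k. ell2_dist (tuples C k) (rank_one C k)"
  have top: "h \<in> topspace ?T \<longleftrightarrow> (\<forall>k. h k \<in> sym_ball C k)" for h
    by (auto simp: topspace_sym_ball_topology)
  have "openin ?T {h \<in> topspace ?T. partition_map C h F \<in> U}" if U: "open U" for U
  proof (subst openin_subopen, intro ballI)
    fix h assume h: "h \<in> {h \<in> topspace ?T. partition_map C h F \<in> U}"
    then have hb: "\<And>k. h k \<in> sym_ball C k" using top by blast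
    obtain \<epsilon> where \<epsilon>: "\<epsilon> > 0" "\<And>y. \<bar>partition_map C h F - y\<bar> < \<epsilon> \<Longrightarrow> y \<in> U"
      using h U unfolding open_dist by (auto simp: dist_real_def abs_minus_commute)
    \<comment> \<open>There are \<open>card V\<close> summands below \<delta>; the added 1 keeps
      their total strictly below \<epsilon> and allows an empty \<open>V\<close>.\<close>
    define \<delta> where "\<delta> = \<epsilon> / (card V + 1)"
    have \<delta>: "\<delta> > 0" using \<epsilon> by (simp add: \<delta>_def)
    \<comment> \<open>An open box around \<open>h\<close>, restricted only at the degrees that occur
      in \<open>F\<close>.\<close>
    define N where "N = (\<lambda>k. if k \<in> vertex_degree F ` V
        then {y \<in> sym_ball C k. ?d k (h k) y < \<delta>} else sym_ball C k)"
    have "finite {k. N k \<noteq> topspace (sym_ball_topology C k)}"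
      by (rule finite_subset[of _ "vertex_degree F ` V"])
        (use fin in \<open>auto simp: N_def topspace_sym_ball_topology\<close>)
    moreover have "openin (sym_ball_topology C k) (N k)" for k
      using openin_sym_ball[OF hb] openin_topspace[of "sym_ball_topology C k"]
      by (simp add: N_def topspace_sym_ball_topology)
    ultimately have "openin ?T (PiE UNIV N)"
      by (simp add: openin_PiE_gen)
    moreover have "h \<in> PiE UNIV N"
      using hb \<delta> by (auto simp: N_def ell2_dist_self)
    moreover have "PiE UNIV N \<subseteq> {h \<in> topspace ?T. partition_map C h F \<in> U}"
    proof
      fix g assume g: "g \<in> PiE UNIV N"
      then have "g k \<in> N k" for k by auto
      then have gb: "\<And>k. g k \<in> sym_ball C k"
        and near: "\<And>v. v \<in> V \<Longrightarrow> ?d (vertex_degree F v) (h (vertex_degree F v)) (g (vertex_degree F v)) < \<delta>"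
        unfolding N_def by (metis (mono_tags, lifting) mem_Collect_eq, 
          metis (mono_tags, lifting) mem_Collect_eq imageI)
      have "\<bar>partition_map C h F - partition_map C g F\<bar> \<le> (\<Sum>v\<in>V. \<delta>)"
        using near by (intro order.trans[OF partition_map_lipschitz[OF F VE hb gb]] sum_mono)
          (auto intro: less_imp_le)
      also have "\<dots> < \<epsilon>"
        using \<epsilon> by (simp add: \<delta>_def field_simps)
      finally show "g \<in> {h \<in> topspace ?T. partition_map C h F \<in> U}"
        using \<epsilon>(2) gb top by blast
    qed
    ultimately show "\<exists>T. openin ?T T \<and> h \<in> T \<and> T \<subseteq> {h \<in> topspace ?T. partition_map C h F \<in> U}"
      by blast
  qed
  then show ?thesis by (simp add: continuous_map_def)
qed

theorem theorem2:
  fixes C :: "'c set"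
  shows "continuous_map
           (product_topology (sym_ball_topology C) (UNIV :: nat set))
           (product_topology (\<lambda>_. euclideanreal) (simple_graphs :: 'v sgraph set))
           (partition_map C)"
proof -
  \<comment> \<open>Continuity into a product is componentwise continuity together with
    extensionality of the values.\<close>
  have "partition_map C h \<in> extensional (simple_graphs :: 'v sgraph set)" for h
    by (simp add: partition_map_def)
  then show ?thesis
    by (auto simp: continuous_map_componentwise continuous_map_partition_map_component)
qed

end
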